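(* Consider a two-stage robust optimization problem with fixed recourse and piecewise linear decision rules with axial segmentation, in the setting described in the context. Let $Z^{\mathcal{PL}}_{\mathrm{IA}}$ be the optimal value of the semidefinite programming approximation (obtained by replacing the copositive cone by its inner approximation $\mathcal{IA}(\mathcal K')$) of the copositive reformulation of the piecewise linear decision rule problem, and let $Z^{\mathcal{PL}}_{\mathrm{GWK}}$ be the optimal value of the problem obtained by replacing the lifted set $\mathcal U'$ by the outer approximation $\mathcal U^{**}$ in the piecewise linear decision rule problem. Then $$Z^{\mathcal{PL}}_{\mathrm{IA}}\le Z^{\mathcal{PL}}_{\mathrm{GWK}}.$$
   Context: Notation: $[M]=\{1,\dots,M\}$; $\mathcal S^n$ symmetric $n\times n$ matrices; $\succeq\boldsymbol 0$ positive semidefinite; $\ge\boldsymbol 0$ componentwise. Uncertainty set: $\mathcal U=\{\boldsymbol u\in\mathcal K:u_{K+1}=1\}$ is polyhedral, with $\mathcal K=\{\boldsymbol u\in\mathbb R^K\times\mathbb R_+:\widehat{\boldsymbol P}\boldsymbol u\ge\boldsymbol 0\}$, and $\mathcal U$ is nonempty and compact. $[\underline u_k,\overline u_k]$ is the marginal support of the $k$-th uncertain parameter, and for every $k\in[K]$ breakpoints $\underline u_k=h_{k,1}<h_{k,2}<\dots<h_{k,L}<h_{k,L+1}=\overline u_k$ are prescribed. Two-stage problem with fixed recourse: data $\mathcal X\subseteq\mathbb R^M$, $\boldsymbol c\in\mathbb R^M$, $\widehat{\boldsymbol d}\in\mathbb R^N$, $\widehat{\boldsymbol B}\in\mathbb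 R^{J\times N}$ with $j$-th row $\widehat{\boldsymbol b}_j^\top$, $\boldsymbol{\mathcal A}(\boldsymbol u)=\sum_{k=1}^{K+1}u_k\widehat{\boldsymbol A}_k$ with $\widehat{\boldsymbol A}_k\in\mathbb R^{J\times M}$, $\boldsymbol h(\boldsymbol u)=\widehat{\boldsymbol H}\boldsymbol u$ with $\widehat{\boldsymbol H}=(\widehat{\boldsymbol h}_1,\dots,\widehat{\boldsymbol h}_J)^\top\in\mathbb R^{J\times(K+1)}$. For a set $\mathcal V$ of vectors $(\boldsymbol w,\boldsymbol u)\in\mathbb R^{KL}\times\mathbb R^{K+1}$ let $$Z(\mathcal V)=\inf_{\boldsymbol x\in\mathcal X,\ \boldsymbol Y\in\mathbb R^{N\times(KL+K+1)}}\Big\{\boldsymbol c^\top\boldsymbol x+\sup_{(\boldsymbol w,\boldsymbol u)\in\mathcal V}\widehat{\boldsymbol d}^\top\boldsymbol Y(\boldsymbol w^\top,\boldsymbol u^\top)^\top:\ \boldsymbol{\mathcal A}(\boldsymbol u)\boldsymbol x+\widehat{\boldsymbol B}\boldsymbol Y(\boldsymbol w^\top,\boldsymbol u^\top)^\top\ge\boldsymbol h(\boldsymbol u)\ \forall(\boldsymbol w,\boldsymbol u)\in\mathcal V\Big\}.$$ The piecewise linear decision rule problem is $Z(\mathcal U')$, where $\mathcal U'$ is the lifted set, consisting of $(\boldsymbol w,\boldsymbol u)\in\mathbb R^{KL}\times\mathcal U$ for which there is $\boldsymbol z\in\mathbb R_+^{K(L+1)}$ with $w_{k,\ell}=z_{k,\ell}-z_{k,\ell+1}$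 ($\ell\in[L]$), $z_{k,1}=u_k-\underline u_k$, $z_{k,L+1}=0$, $z_{k,\ell}\ge u_k-h_{k,\ell}$, $\overline u_k\ge z_{k,\ell}$, $z_{k,\ell}(z_{k,\ell}-u_k+h_{k,\ell})=0$ ($\ell\in[L+1]$), for all $k\in[K]$; it is introduced as the reformulation of $w_{k,\ell}=\max\{0,u_k-h_{k,\ell}\}-\max\{0,u_k-h_{k,\ell+1}\}$. $Z^{\mathcal{PL}}_{\mathrm{GWK}}=Z(\mathcal U^{**})$, where $$\mathcal U^{**}=\left\{(\boldsymbol w,\boldsymbol u)\in\mathbb R^{KL}\times\mathcal U:\begin{array}{ll}u_k-\underline u_k=\sum_{\ell\in[L]}w_{k,\ell}&\forall k\in[K]\\ h_{k,2}-\underline u_k\ge w_{k,1}&\forall k\in[K]\\ (h_{k,\ell+1}-h_{k,\ell})w_{k,\ell-1}\ge(h_{k,\ell}-h_{k,\ell-1})w_{k,\ell}&\forall k\in[K],\ \ell\in[L]\setminus\{1\}\end{array}\right\}.$$ Copositive reformulation and its approximation: let $\mathcal K'$ be the cone of $\boldsymbol\psi=(\boldsymbol w,\boldsymbol z,\boldsymbol u)\in\mathbb R^{KL}\times\mathbb R_+^{K(L+1)}\times\mathcal K$ with, for all $k\in[K]$, $w_{k,\ell}=z_{k,\ell}-z_{k,\ell+1}$ ($\ell\in[L]$), $z_{k,1}=u_k-\underline u_ku_{K+1}$, $z_{k,L+1}=0$, $z_{k,\ell}\ge u_k-h_{k,\ell}u_{K+1}$, $\overline u_ku_{K+1}\ge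 z_{k,\ell}$ ($\ell\in[L+1]$). Let $n'=KL+K(L+1)+K+1$, let $\mathbf e\in\mathbb R^{n'}$ be the last standard basis vector, and write $\mathcal K'=\{\boldsymbol\psi:\widehat{\boldsymbol P}'\boldsymbol\psi\ge\boldsymbol 0\}$, the rows of $\widehat{\boldsymbol P}'$ listing all linear inequalities in this description (including $u_{K+1}\ge0$; each equality is written as two opposite inequalities). The inner approximation of $\mathcal{COP}(\mathcal K')=\{\boldsymbol V:\boldsymbol\psi^\top\boldsymbol V\boldsymbol\psi\ge0\ \forall\boldsymbol\psi\in\mathcal K'\}$ is $\mathcal{IA}(\mathcal K')=\{\boldsymbol W+(\widehat{\boldsymbol P}')^\top\boldsymbol\Sigma\widehat{\boldsymbol P}':\boldsymbol W\in\mathcal S^{n'},\boldsymbol W\succeq\boldsymbol 0,\ \boldsymbol\Sigma\text{ symmetric},\ \boldsymbol\Sigma\ge\boldsymbol 0\}$. Let $\widehat{\boldsymbol C}_{k,\ell}\in\mathcal S^{n'}$ be defined by $\boldsymbol\psi^\top\widehat{\boldsymbol C}_{k,\ell}\boldsymbol\psi=z_{k,\ell}(z_{k,\ell}-u_k+h_{k,\ell}u_{K+1})$; let $\widehat{\boldsymbol\Theta}'_j\in\mathbb R^{n'\times M}$, $\widehat{\boldsymbol h}'_j\in\mathbb R^{n'}$ be such that $\boldsymbol\psi^\top\widehat{\boldsymbol\Theta}'_j\boldsymbol x=[\boldsymbol{\mathcal A}(\boldsymbol u)\boldsymbol x]_j$ and $(\widehat{\boldsymbol h}'_j)^\top\boldsymbol\psi=[\boldsymbol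 h(\boldsymbol u)]_j$; and for $\boldsymbol Y\in\mathbb R^{N\times(KL+K+1)}$ let $\boldsymbol Y'\in\mathbb R^{N\times n'}$ be obtained by inserting zero columns at the positions of $\boldsymbol z$, so that $\boldsymbol Y'\boldsymbol\psi=\boldsymbol Y(\boldsymbol w^\top,\boldsymbol u^\top)^\top$. Then $Z^{\mathcal{PL}}_{\mathrm{IA}}$ is the optimal value of $$\begin{array}{rl}\inf&\boldsymbol c^\top\boldsymbol x+\lambda\\ \text{s.t.}&\lambda\mathbf e\mathbf e^\top-\frac12(\mathbf e\widehat{\boldsymbol d}^\top\boldsymbol Y'+(\boldsymbol Y')^\top\widehat{\boldsymbol d}\mathbf e^\top)+\sum_{k,\ell}\alpha_{k,\ell}\widehat{\boldsymbol C}_{k,\ell}\in\mathcal{IA}(\mathcal K')\\ &\frac12\big(\widehat{\boldsymbol\Theta}'_j\boldsymbol x\mathbf e^\top+\mathbf e\boldsymbol x^\top(\widehat{\boldsymbol\Theta}'_j)^\top+\mathbf e\widehat{\boldsymbol b}_j^\top\boldsymbol Y'+(\boldsymbol Y')^\top\widehat{\boldsymbol b}_j\mathbf e^\top-\widehat{\boldsymbol h}'_j\mathbf e^\top-\mathbf e(\widehat{\boldsymbol h}'_j)^\top\big)-\pi_j\mathbf e\mathbf e^\top-\sum_{k,\ell}\beta_{j,k,\ell}\widehat{\boldsymbol C}_{k,\ell}\in\mathcal{IA}(\mathcal K')\ \ \forall j\in[J]\end{array}$$ over $\boldsymbol x\in\mathcal X$, $\lambda\in\mathbb R$, $\boldsymbol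 Y\in\mathbb R^{N\times(KL+K+1)}$, $\boldsymbol\pi\in\mathbb R_+^J$, $\alpha_{k,\ell},\beta_{j,k,\ell}\in\mathbb R$ (with $k\in[K]$, $\ell\in[L+1]$). *)

theory Defs
  imports "HOL-Analysis.Analysis"
begin

text \<open>
  Index types. The set of uncertain parameters \<open>[K]\<close> is a finite type \<open>'k\<close>, and \<open>[K + 1]\<close> is
  \<open>'k option\<close> with \<open>None\<close> as the last position. The set \<open>[L]\<close> is a finite linearly ordered type
  \<open>'l\<close> (so \<open>L \<ge> 1\<close>, and every finite nonempty linear order is isomorphic to some \<open>[L]\<close>), and
  \<open>[L + 1]\<close> is \<open>'l option\<close> with \<open>None\<close> as the position \<open>L + 1\<close>. The linear order on
  \<open>[L + 1]\<close> enters only through \<open>fst_ix\<close> (the position 1) and \<open>nxt\<close>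
  (the map sending a position of \<open>[L]\<close> to the next one in \<open>[L + 1]\<close>).
  Vectors \<open>(w, u)\<close> are indexed by \<open>'k \<times> 'l + 'k option\<close>, and vectors \<open>(w, z, u)\<close> by
  \<open>'k \<times> 'l + 'k \<times> 'l option + 'k option\<close>.
\<close>

definition fst_ix :: "'l::{finite,linorder}" where
  "fst_ix = Min UNIV"

definition nxt :: "'l::{finite,linorder} \<Rightarrow> 'l option" where
  "nxt l = (if l = Max UNIV then None else Some (Min {l'. l < l'}))"

type_synonym ('k, 'l) wu_ix = "('k \<times> 'l) + 'k option"
type_synonym ('k, 'l) psi_ix = "('k \<times> 'l) + ('k \<times> 'l option) + 'k option"


subsection \<open>Uncertainty set and decision rule problems\<close>

definition cone_K :: "real^('k::finite option)^('p::finite) \<Rightarrow> (real^('k option)) set" where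
  "cone_K P = {u. 0 \<le> u $ None \<and> 0 \<le> P *v u}"

definition unc_set :: "real^('k::finite option)^('p::finite) \<Rightarrow> (real^('k option)) set" where
  "unc_set P = {u \<in> cone_K P. u $ None = 1}"

definition stack :: "real^('k \<times> 'l) \<Rightarrow> real^('k option) \<Rightarrow> real^('k::finite, 'l::finite) wu_ix" where
  "stack w u = (\<chi> i. case i of Inl kl \<Rightarrow> w $ kl | Inr k \<Rightarrow> u $ k)"

definition lin_mat :: "('k::finite option \<Rightarrow> real^('m::finite)^('j::finite)) \<Rightarrow> real^('k option) \<Rightarrow> real^'m^'j" where
  "lin_mat A u = (\<Sum>k\<in>UNIV. u $ k *\<^sub>R A k)"

definition Z_val ::
  "(real^'m) set \<Rightarrow> real^'m \<Rightarrow> real^'n \<Rightarrow> ('k option \<Rightarrow> real^'m^'j) \<Rightarrow> real^'n^'j \<Rightarrow> real^('k option)^'j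
    \<Rightarrow> ((real^('k::finite \<times> 'l::finite)) \<times> (real^('k option))) set \<Rightarrow> ereal" where
  "Z_val (X :: (real^'m::finite) set) c (d :: real^'n::finite) A (B :: real^'n^'j::finite) H V =
    Inf {ereal (c \<bullet> x) + (SUP (w, u)\<in>V. ereal (d \<bullet> (Y *v stack w u))) | x (Y :: real^('k, 'l) wu_ix^'n).
           x \<in> X \<and> (\<forall>(w, u)\<in>V. lin_mat A u *v x + B *v (Y *v stack w u) \<ge> H *v u)}"

text \<open>The lifted set; \<open>Z_val\<close> of this set is the piecewise linear decision rule problem.\<close>

definition U_lift ::
  "real^('k option)^'p::finite \<Rightarrow> ('k \<Rightarrow> real) \<Rightarrow> ('k \<Rightarrow> real) \<Rightarrow> ('k \<Rightarrow> 'l option \<Rightarrow> real)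
    \<Rightarrow> ((real^('k::finite \<times> 'l::{finite,linorder})) \<times> (real^('k option))) set" where
  "U_lift P lo hi h = {(w, u). u \<in> unc_set P \<and>
     (\<exists>z :: real^('k \<times> 'l option). 0 \<le> z \<and>
       (\<forall>k. (\<forall>l. w $ (k, l) = z $ (k, Some l) - z $ (k, nxt l)) \<and>
            z $ (k, Some fst_ix) = u $ Some k - lo k \<and>
            z $ (k, None) = 0 \<and>
            (\<forall>l. z $ (k, l) \<ge> u $ Some k - h k l \<and>
                 hi k \<ge> z $ (k, l) \<and>
                 z $ (k, l) * (z $ (k, l) - u $ Some k + h k l) = 0)))}"

definition U_GWK ::
  "real^('k option)^'p::finite \<Rightarrow> ('k \<Rightarrow> real) \<Rightarrow> ('k \<Rightarrow> 'l option \<Rightarrow> real)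
    \<Rightarrow> ((real^('k::finite \<times> 'l::{finite,linorder})) \<times> (real^('k option))) set" where
  "U_GWK P lo h = {(w, u). u \<in> unc_set P \<and>
     (\<forall>k. u $ Some k - lo k = (\<Sum>l\<in>UNIV. w $ (k, l))) \<and>
     (\<forall>k. h k (nxt fst_ix) - lo k \<ge> w $ (k, fst_ix)) \<and>
     (\<forall>k l' l. nxt l' = Some l \<longrightarrow>
        (h k (nxt l) - h k (Some l)) * w $ (k, l') \<ge> (h k (Some l) - h k (Some l')) * w $ (k, l))}"


subsection \<open>The lifted cone and its matrix of linear inequalities\<close>

definition w_of :: "real^('k, 'l) psi_ix \<Rightarrow> real^('k::finite \<times> 'l::finite)" where
  "w_of \<psi> = (\<chi> i. \<psi> $ Inl i)"

definition z_of :: "real^('k, 'l) psi_ix \<Rightarrow> real^('k::finite \<times> 'l::finite option)" where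
  "z_of \<psi> = (\<chi> i. \<psi> $ Inr (Inl i))"

definition u_of :: "real^('k, 'l::finite) psi_ix \<Rightarrow> real^('k::finite option)" where
  "u_of \<psi> = (\<chi> i. \<psi> $ Inr (Inr i))"

definition cone_K' ::
  "real^('k option)^'p::finite \<Rightarrow> ('k \<Rightarrow> real) \<Rightarrow> ('k \<Rightarrow> real) \<Rightarrow> ('k \<Rightarrow> 'l option \<Rightarrow> real)
    \<Rightarrow> (real^('k::finite, 'l::{finite,linorder}) psi_ix) set" where
  "cone_K' P lo hi h = {\<psi>. let w = w_of \<psi>; z = z_of \<psi>; u = u_of \<psi> in
     0 \<le> z \<and> u \<in> cone_K P \<and>
     (\<forall>k. (\<forall>l. w $ (k, l) = z $ (k, Some l) - z $ (k, nxt l)) \<and>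
          z $ (k, Some fst_ix) = u $ Some k - lo k * u $ None \<and>
          z $ (k, None) = 0 \<and>
          (\<forall>l. z $ (k, l) \<ge> u $ Some k - h k l * u $ None \<and>
               hi k * u $ None \<ge> z $ (k, l)))}"

text \<open>
  Row labels of the constraint matrix of the lifted cone. The Boolean argument selects one of the
  two opposite inequalities that encode an equality.
\<close>

datatype ('p, 'k, 'l) cone_row =
    Row_P 'p
  | Row_last
  | Row_z_nonneg 'k "'l option"
  | Row_w bool 'k 'l
  | Row_z_first bool 'k
  | Row_z_last bool 'k
  | Row_z_lower 'k "'l option"
  | Row_z_upper 'k "'l option"

instance cone_row :: (finite, finite, finite) finite
proof
  have "(UNIV :: ('a, 'b, 'c) cone_row set) \<subseteq>
      range Row_P \<union> {Row_last} \<union> range (case_prod Row_z_nonneg)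
      \<union> range (\<lambda>(s, k, l). Row_w s k l) \<union> range (case_prod Row_z_first)
      \<union> range (case_prod Row_z_last) \<union> range (case_prod Row_z_lower)
      \<union> range (case_prod Row_z_upper)"
  proof
    fix r :: "('a, 'b, 'c) cone_row"
    show "r \<in> range Row_P \<union> {Row_last} \<union> range (case_prod Row_z_nonneg)
      \<union> range (\<lambda>(s, k, l). Row_w s k l) \<union> range (case_prod Row_z_first)
      \<union> range (case_prod Row_z_last) \<union> range (case_prod Row_z_lower)
      \<union> range (case_prod Row_z_upper)"
      by (cases r) (auto simp: image_iff)
  qed
  then show "finite (UNIV :: ('a, 'b, 'c) cone_row set)"
    by (rule finite_subset) simp
qed

abbreviation bas_w :: "'k \<Rightarrow> 'l \<Rightarrow> real^('k::finite, 'l::finite) psi_ix" where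
  "bas_w k l \<equiv> axis (Inl (k, l)) 1"

abbreviation bas_z :: "'k \<Rightarrow> 'l option \<Rightarrow> real^('k::finite, 'l::finite) psi_ix" where
  "bas_z k l \<equiv> axis (Inr (Inl (k, l))) 1"

abbreviation bas_u :: "'k option \<Rightarrow> real^('k::finite, 'l::finite) psi_ix" where
  "bas_u k \<equiv> axis (Inr (Inr k)) 1"

abbreviation e_last :: "real^('k::finite, 'l::finite) psi_ix" where
  "e_last \<equiv> bas_u None"

definition u_embed :: "real^('k::finite option) \<Rightarrow> real^('k, 'l::finite) psi_ix" where
  "u_embed a = (\<chi> i. case i of Inl _ \<Rightarrow> 0 | Inr (Inl _) \<Rightarrow> 0 | Inr (Inr k) \<Rightarrow> a $ k)"

definition both :: "bool \<Rightarrow> 'a::real_vector \<Rightarrow> 'a" where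
  "both s a = (if s then a else - a)"

definition P_lift ::
  "real^('k option)^'p \<Rightarrow> ('k \<Rightarrow> real) \<Rightarrow> ('k \<Rightarrow> real) \<Rightarrow> ('k \<Rightarrow> 'l option \<Rightarrow> real)
    \<Rightarrow> real^('k::finite, 'l::{finite,linorder}) psi_ix^('p::finite, 'k, 'l) cone_row" where
  "P_lift P lo hi h = (\<chi> r. case r of
      Row_P i \<Rightarrow> u_embed (P $ i)
    | Row_last \<Rightarrow> e_last
    | Row_z_nonneg k l \<Rightarrow> bas_z k l
    | Row_w s k l \<Rightarrow> both s (bas_w k l - (bas_z k (Some l) - bas_z k (nxt l)))
    | Row_z_first s k \<Rightarrow> both s (bas_z k (Some fst_ix) - (bas_u (Some k) - lo k *\<^sub>R e_last))
    | Row_z_last s k \<Rightarrow> both s (bas_z k None)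
    | Row_z_lower k l \<Rightarrow> bas_z k l - (bas_u (Some k) - h k l *\<^sub>R e_last)
    | Row_z_upper k l \<Rightarrow> hi k *\<^sub>R e_last - bas_z k l)"

lemma sum_UNIV_Plus:
  "sum f (UNIV :: ('a::finite + 'b::finite) set) = (\<Sum>x\<in>UNIV. f (Inl x)) + (\<Sum>x\<in>UNIV. f (Inr x))"
  by (subst UNIV_Plus_UNIV[symmetric], subst sum.Plus) simp_all

lemma inner_u_embed: "u_embed a \<bullet> \<psi> = a \<bullet> u_of \<psi>"
  by (simp add: inner_vec_def u_embed_def u_of_def sum_UNIV_Plus)

lemma cone_K'_eq_P_lift: "cone_K' P lo hi h = {\<psi>. 0 \<le> P_lift P lo hi h *v \<psi>}"
proof -
  have eq: "(\<forall>s. 0 \<le> both s a \<bullet> b) \<longleftrightarrow> a \<bullet> b = 0" for a b :: "'z::real_inner"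
    by (auto simp: both_def all_bool_eq)
  have split: "(\<forall>r. Q r) \<longleftrightarrow> (\<forall>i. Q (Row_P i)) \<and> Q Row_last \<and> (\<forall>k l. Q (Row_z_nonneg k l)) \<and>
      (\<forall>k l s. Q (Row_w s k l)) \<and> (\<forall>k s. Q (Row_z_first s k)) \<and> (\<forall>k s. Q (Row_z_last s k)) \<and>
      (\<forall>k l. Q (Row_z_lower k l)) \<and> (\<forall>k l. Q (Row_z_upper k l))"
    for Q :: "('p::finite, 'k::finite, 'l::{finite,linorder}) cone_row \<Rightarrow> bool"
    by (metis cone_row.exhaust)
  show ?thesis
    unfolding less_eq_vec_def split set_eq_iff mem_Collect_eq
    by (auto simp: P_lift_def matrix_vector_mul_component inner_u_embed eq cone_K'_def cone_K_def
        less_eq_vec_def inner_diff_left inner_axis' w_of_def z_of_def u_of_def Let_def)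
qed


subsection \<open>Copositive cone, inner approximation and the copositive programs\<close>

definition psd :: "real^'i^'i::finite \<Rightarrow> bool" where
  "psd W \<longleftrightarrow> transpose W = W \<and> (\<forall>v. 0 \<le> v \<bullet> (W *v v))"

definition COP :: "(real^'i) set \<Rightarrow> (real^'i^'i::finite) set" where
  "COP C = {V. \<forall>v\<in>C. 0 \<le> v \<bullet> (V *v v)}"

definition IA :: "real^'i^'r \<Rightarrow> (real^'i^'i::finite) set" where
  "IA P = {W + transpose P ** S ** P | W (S :: real^'r^'r::finite).
             psd W \<and> transpose S = S \<and> 0 \<le> S}"

definition outer :: "real^'i \<Rightarrow> real^'j \<Rightarrow> real^'j::finite^'i::finite" where
  "outer a b = (\<chi> i j. a $ i * b $ j)"

definition C_mat :: "('k \<Rightarrow> 'l option \<Rightarrow> real) \<Rightarrow> 'k \<Rightarrow> 'l option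
    \<Rightarrow> real^('k::finite, 'l::finite) psi_ix^('k, 'l) psi_ix" where
  "C_mat h k l = (let a = bas_z k l; b = bas_z k l - bas_u (Some k) + h k l *\<^sub>R e_last
                  in (1/2) *\<^sub>R (outer a b + outer b a))"

definition Theta :: "('k option \<Rightarrow> real^'m^'j) \<Rightarrow> 'j
    \<Rightarrow> real^'m::finite^('k::finite, 'l::finite) psi_ix" where
  "Theta A j = (\<chi> i. case i of Inl _ \<Rightarrow> 0 | Inr (Inl _) \<Rightarrow> 0 | Inr (Inr k) \<Rightarrow> A k $ j)"

definition Y_embed :: "real^('k, 'l) wu_ix^'n \<Rightarrow> real^('k::finite, 'l::finite) psi_ix^'n::finite" where
  "Y_embed Y = (\<chi> n i. case i of Inl kl \<Rightarrow> Y $ n $ Inl kl | Inr (Inl _) \<Rightarrow> 0 | Inr (Inr k) \<Rightarrow> Y $ n $ Inr k)"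

lemma inner_outer: "v \<bullet> (outer a b *v v) = (v \<bullet> a) * (b \<bullet> v)"
proof -
  have "outer a b *v v = (b \<bullet> v) *\<^sub>R a"
    by (simp add: outer_def matrix_vector_mult_def inner_vec_def vec_eq_iff sum_distrib_left
        sum_distrib_right mult_ac)
  then show ?thesis
    by simp
qed

lemma transpose_C_mat: "transpose (C_mat h k l) = C_mat h k l"
  by (simp add: C_mat_def Let_def outer_def transpose_def vec_eq_iff algebra_simps)

lemma quadratic_form_C_mat:
  "\<psi> \<bullet> (C_mat h k l *v \<psi>) =
     z_of \<psi> $ (k, l) * (z_of \<psi> $ (k, l) - u_of \<psi> $ Some k + h k l * u_of \<psi> $ None)"
  by (simp add: C_mat_def Let_def scaleR_matrix_vector_assoc[symmetric] matrix_vector_mult_add_rdistrib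
      inner_add_right inner_outer inner_diff_left inner_diff_right inner_add_left inner_axis
      inner_axis' z_of_def u_of_def)

lemma inner_Theta: "\<psi> \<bullet> (Theta A j *v x) = (lin_mat A (u_of \<psi>) *v x) $ j"
proof -
  have "\<psi> \<bullet> (Theta A j *v x) = (\<Sum>k\<in>UNIV. u_of \<psi> $ k * (A k $ j \<bullet> x))"
    by (simp add: inner_vec_def Theta_def u_of_def matrix_vector_mult_def inner_vec_def sum_UNIV_Plus)
  also have "\<dots> = (lin_mat A (u_of \<psi>) *v x) $ j"
    by (simp add: lin_mat_def matrix_vector_mul_component inner_sum_left)
  finally show ?thesis .
qed

lemma Y_embed_mult: "Y_embed Y *v \<psi> = Y *v stack (w_of \<psi>) (u_of \<psi>)"
  by (simp add: vec_eq_iff matrix_vector_mult_def Y_embed_def stack_def w_of_def u_of_def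
      sum_UNIV_Plus)

text \<open>
  The copositive program over a given matrix cone \<open>C\<close>: the copositive reformulation is the case
  \<open>C = COP (cone_K' P lo hi h)\<close>, and its semidefinite approximation is the case
  \<open>C = IA (P_lift P lo hi h)\<close>. The vector \<open>u_embed (H $ j)\<close> represents the
  \<open>j\<close>-th component of \<open>H *v u\<close> as a linear function of \<open>(w, z, u)\<close>.
\<close>

definition cop_objective_mat ::
  "('k \<Rightarrow> 'l option \<Rightarrow> real) \<Rightarrow> real^'n \<Rightarrow> real \<Rightarrow> real^('k, 'l) wu_ix^'n \<Rightarrow> ('k \<Rightarrow> 'l option \<Rightarrow> real)
    \<Rightarrow> real^('k::finite, 'l::finite) psi_ix^('k, 'l) psi_ix" where
  "cop_objective_mat h d lam (Y :: real^('k, 'l) wu_ix^'n::finite) \<alpha> =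
     (let g = transpose (Y_embed Y) *v d in
       lam *\<^sub>R outer e_last e_last - (1/2) *\<^sub>R (outer e_last g + outer g e_last)
       + (\<Sum>k\<in>UNIV. \<Sum>l\<in>UNIV. \<alpha> k l *\<^sub>R C_mat h k l))"

definition cop_constraint_mat ::
  "('k \<Rightarrow> 'l option \<Rightarrow> real) \<Rightarrow> ('k option \<Rightarrow> real^'m^'j) \<Rightarrow> real^'n^'j \<Rightarrow> real^('k option)^'j \<Rightarrow> 'j
    \<Rightarrow> real^'m \<Rightarrow> real^('k, 'l) wu_ix^'n \<Rightarrow> real \<Rightarrow> ('k \<Rightarrow> 'l option \<Rightarrow> real)
    \<Rightarrow> real^('k::finite, 'l::finite) psi_ix^('k, 'l) psi_ix" where
  "cop_constraint_mat h A (B :: real^'n^'j::finite) H j (x :: real^'m::finite)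
       (Y :: real^('k, 'l) wu_ix^'n::finite) \<pi>j \<beta>j =
     (let t = Theta A j *v x; b = transpose (Y_embed Y) *v (B $ j); hj = u_embed (H $ j) in
       (1/2) *\<^sub>R (outer t e_last + outer e_last t + outer e_last b + outer b e_last
                 - outer hj e_last - outer e_last hj)
       - \<pi>j *\<^sub>R outer e_last e_last
       - (\<Sum>k\<in>UNIV. \<Sum>l\<in>UNIV. \<beta>j k l *\<^sub>R C_mat h k l))"

definition cop_value ::
  "('k \<Rightarrow> 'l option \<Rightarrow> real)
    \<Rightarrow> (real^'m) set \<Rightarrow> real^'m \<Rightarrow> real^'n \<Rightarrow> ('k option \<Rightarrow> real^'m^'j) \<Rightarrow> real^'n^'j \<Rightarrow> real^('k option)^'j
    \<Rightarrow> (real^('k::finite, 'l::finite) psi_ix^('k, 'l) psi_ix) set \<Rightarrow> ereal" where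
  "cop_value h (X :: (real^'m::finite) set) c (d :: real^'n::finite) A (B :: real^'n^'j::finite) H C =
     Inf {ereal (c \<bullet> x + lam) | x lam (Y :: real^('k, 'l) wu_ix^'n) \<pi> \<alpha> \<beta>.
            x \<in> X \<and> (\<forall>j. 0 \<le> \<pi> j) \<and>
            cop_objective_mat h d lam Y \<alpha> \<in> C \<and>
            (\<forall>j. cop_constraint_mat h A B H j x Y (\<pi> j) (\<beta> j) \<in> C)}"

definition Z_GWK where
  "Z_GWK P lo h X c d A B H = Z_val X c d A B H (U_GWK P lo h)"

definition Z_IA where
  "Z_IA P lo hi h X c d A B H = cop_value h X c d A B H (IA (P_lift P lo hi h))"

end

theory Submission
  imports Defs
begin

text \<open>
  The outer approximation contains the points with
  \<open>w\<^sub>k\<^sub>,\<^sub>l = (h\<^sub>k\<^sub>,\<^sub>l\<^sub>+\<^sub>1 - h\<^sub>k\<^sub>,\<^sub>l) (u\<^sub>k - lo\<^sub>k) / (hi\<^sub>k - lo\<^sub>k)\<close>, which depend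
  linearly on \<open>u\<close> (as \<open>u\<^sub>K\<^sub>+\<^sub>1 = 1\<close>). Hence a decision rule that is feasible on the outer
  approximation can be replaced, without increasing its worst-case cost, by one that ignores
  \<open>w\<close> and is linear in \<open>u\<close>. For such a rule every semi-infinite constraint says that a
  linear form \<open>g\<close> is nonnegative on the uncertainty set, hence, by compactness, on the cone. By
  Farkas' lemma \<open>g\<close> is a nonnegative combination of rows of the constraint matrix, and the last
  unit vector \<open>e\<close> is itself a row; therefore \<open>(e g\<^sup>T + g e\<^sup>T) / 2\<close> lies in the inner
  approximation, with all multipliers of the complementarity matrices equal to zero.
\<close>

section \<open>Farkas' lemma\<close>

text \<open>Induction on the number of generators, which avoids proving that finitely generated
  cones are closed. If the constraints in \<open>I\<close> already force \<open>b\<close> to be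
  nonnegative, the new generator gets weight 0; otherwise a violating point allows elimination of
  \<open>a i0\<close>.\<close>

lemma farkas:
  fixes a :: "'i \<Rightarrow> 'a::real_inner"
  assumes "finite I"
    and "\<And>x. (\<And>i. i \<in> I \<Longrightarrow> 0 \<le> a i \<bullet> x) \<Longrightarrow> 0 \<le> b \<bullet> x"
  shows "\<exists>\<sigma>. (\<forall>i. 0 \<le> \<sigma> i) \<and> b = (\<Sum>i\<in>I. \<sigma> i *\<^sub>R a i)"
  using assms
proof (induction I arbitrary: a b rule: finite_induct)
  case empty
  have "0 \<le> b \<bullet> (- b)"
    by (rule empty) simp
  then have "b = 0"
    by (metis inner_eq_zero_iff inner_ge_zero inner_minus_right neg_0_le_iff_le order_antisym)
  then show ?case
    by (intro exI[of _ "\<lambda>_. 0"]) simp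
next
  case (insert i0 I)
  show ?case
  proof (cases "\<forall>x. (\<forall>i\<in>I. 0 \<le> a i \<bullet> x) \<longrightarrow> 0 \<le> b \<bullet> x")
    case True
    then obtain \<sigma> where \<sigma>: "\<forall>i. 0 \<le> \<sigma> i" "b = (\<Sum>i\<in>I. \<sigma> i *\<^sub>R a i)"
      using insert.IH[of a b] by blast
    have "(\<Sum>i\<in>I. (\<sigma>(i0 := 0)) i *\<^sub>R a i) = (\<Sum>i\<in>I. \<sigma> i *\<^sub>R a i)"
      using insert.hyps by (intro sum.cong) auto
    then have "b = (\<Sum>i\<in>insert i0 I. (\<sigma>(i0 := 0)) i *\<^sub>R a i)"
      using insert.hyps \<sigma> by simp
    then show ?thesis
      using \<sigma>(1) by (intro exI[of _ "\<sigma>(i0 := 0)"]) simp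
  next
    case False
    then obtain y where y: "\<And>i. i \<in> I \<Longrightarrow> 0 \<le> a i \<bullet> y" "b \<bullet> y < 0"
      by (auto simp: not_le)
    have neg: "a i0 \<bullet> y < 0"
      using insert.prems[of y] y by fastforce
    \<comment> \<open>The violating point \<open>y\<close> is rescaled so that
      \<open>a i0 \<bullet> x0 = - 1\<close>, which removes all denominators from the
      projection.\<close>
    define x0 where "x0 = (- 1 / (a i0 \<bullet> y)) *\<^sub>R y"
    have x0: "a i0 \<bullet> x0 = - 1" "b \<bullet> x0 \<le> 0" "\<And>i. i \<in> I \<Longrightarrow> 0 \<le> a i \<bullet> x0"
      using neg y by (auto simp: x0_def divide_simps mult_le_0_iff)
    \<comment> \<open>Project along \<open>x0\<close> onto the hyperplane \<open>a i0 \<bullet> x = 0\<close>.\<close>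
    define a' where "a' i = a i + (a i \<bullet> x0) *\<^sub>R a i0" for i
    define b' where "b' = b + (b \<bullet> x0) *\<^sub>R a i0"
    have "0 \<le> b' \<bullet> x" if "\<And>i. i \<in> I \<Longrightarrow> 0 \<le> a' i \<bullet> x" for x
    proof -
      \<comment> \<open>\<open>z\<close> is the projection of \<open>x\<close>: it satisfies
        \<open>a i0 \<bullet> z = 0\<close>, \<open>a i \<bullet> z = a' i \<bullet> x\<close> and
        \<open>b \<bullet> z = b' \<bullet> x\<close>.\<close>
      define z where "z = x + (a i0 \<bullet> x) *\<^sub>R x0"
      have "0 \<le> a i \<bullet> z" if "i \<in> insert i0 I" for i
        using that \<open>\<And>i. i \<in> I \<Longrightarrow> 0 \<le> a' i \<bullet> x\<close>[of i] x0(1)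
        by (auto simp: z_def a'_def inner_add_right inner_add_left mult.commute)
      then have "0 \<le> b \<bullet> z"
        by (rule insert.prems)
      then show ?thesis
        by (simp add: z_def b'_def inner_add_right inner_add_left mult.commute)
    qed
    then obtain \<sigma> where \<sigma>: "\<forall>i. 0 \<le> \<sigma> i" "b' = (\<Sum>i\<in>I. \<sigma> i *\<^sub>R a' i)"
      using insert.IH[of a' b'] by blast
    \<comment> \<open>The coefficient of \<open>a i0\<close> once \<open>a'\<close> and
      \<open>b'\<close> are expanded; it is nonnegative because
      \<open>b \<bullet> x0 \<le> 0\<close>.\<close>
    define s where "s = (\<Sum>i\<in>I. \<sigma> i * (a i \<bullet> x0)) - b \<bullet> x0"
    have "0 \<le> s"
      using \<sigma>(1) x0 sum_nonneg[of I "\<lambda>i. \<sigma> i * (a i \<bullet> x0)"] by (simp add: s_def)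
    have "(\<Sum>i\<in>I. (\<sigma>(i0 := s)) i *\<^sub>R a i) = (\<Sum>i\<in>I. \<sigma> i *\<^sub>R a i)"
      using insert.hyps by (intro sum.cong) auto
    moreover have "b = (\<Sum>i\<in>I. \<sigma> i *\<^sub>R a i) + s *\<^sub>R a i0"
      using \<sigma>(2) by (simp add: a'_def b'_def s_def algebra_simps sum.distrib scaleR_sum_left)
    ultimately have "b = (\<Sum>i\<in>insert i0 I. (\<sigma>(i0 := s)) i *\<^sub>R a i)"
      using insert.hyps by simp
    then show ?thesis
      using \<sigma>(1) \<open>0 \<le> s\<close> by (intro exI[of _ "\<sigma>(i0 := s)"]) simp
  qed
qed

section \<open>From the uncertainty set to its cone\<close>

text \<open>A cone point with positive last entry scales into the uncertainty set; one with last
  entry 0 is a recession direction, which boundedness forces to vanish.\<close>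

lemma nonneg_on_cone_K:
  assumes "unc_set P \<noteq> {}" "compact (unc_set P)"
    and g: "\<And>u. u \<in> unc_set P \<Longrightarrow> 0 \<le> g \<bullet> u"
    and u: "u \<in> cone_K P"
  shows "0 \<le> g \<bullet> u"
proof (cases "u $ None = 0")
  case True
  obtain u0 where u0: "u0 \<in> unc_set P"
    using assms(1) by blast
  have ray: "u0 + t *\<^sub>R u \<in> unc_set P" if "0 \<le> t" for t
    using u0 u True that
    by (simp add: unc_set_def cone_K_def matrix_vector_right_distrib matrix_vector_mult_scaleR
        add_nonneg_nonneg scaleR_nonneg_nonneg)
  obtain R where R: "\<And>v. v \<in> unc_set P \<Longrightarrow> norm v \<le> R"
    using compact_imp_bounded[OF assms(2)] by (auto simp: bounded_iff)
  have "u = 0"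
  proof (rule ccontr)
    assume "u \<noteq> 0"
    \<comment> \<open>Makes \<open>t *\<^sub>R u\<close> have norm \<open>2 * R + 1\<close>, while a
      difference of two points of the set has norm at most \<open>2 * R\<close>.\<close>
    define t where "t = (2 * R + 1) / norm u"
    have "0 \<le> R"
      using R[OF u0] norm_ge_zero order_trans by blast
    then have t: "0 \<le> t"
      by (simp add: t_def)
    have "norm (t *\<^sub>R u) = 2 * R + 1"
      using \<open>u \<noteq> 0\<close> \<open>0 \<le> R\<close> by (simp add: t_def)
    moreover have "norm (t *\<^sub>R u) \<le> norm (u0 + t *\<^sub>R u) + norm u0"
      using norm_triangle_ineq4[of "u0 + t *\<^sub>R u" u0] by simp
    ultimately show False
      using R[OF u0] R[OF ray[OF t]] by simp
  qed
  then show ?thesis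
    by simp
next
  case False
  then have pos: "0 < u $ None"
    using u by (simp add: cone_K_def)
  then have "(1 / u $ None) *\<^sub>R u \<in> unc_set P"
    using u by (simp add: unc_set_def cone_K_def matrix_vector_mult_scaleR scaleR_nonneg_nonneg)
  from g[OF this] show ?thesis
    using pos by (simp add: zero_le_divide_iff)
qed

lemma nonneg_on_unc_set_imp_combination:
  fixes P :: "real^('k::finite option)^('p::finite)"
  assumes "unc_set P \<noteq> {}" "compact (unc_set P)"
    and "\<And>u. u \<in> unc_set P \<Longrightarrow> 0 \<le> g \<bullet> u"
  obtains \<sigma> \<sigma>0 where "\<And>i. 0 \<le> \<sigma> i" "0 \<le> \<sigma>0"
    "g = (\<Sum>i\<in>UNIV. \<sigma> i *\<^sub>R P $ i) + \<sigma>0 *\<^sub>R axis None 1"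
proof -
  \<comment> \<open>\<open>None\<close> labels the additional inequality that the last entry of
    \<open>u\<close> is nonnegative.\<close>
  define a where "a = case_option (axis None 1) (($) P)"
  have "0 \<le> g \<bullet> u" if "\<And>r. r \<in> UNIV \<Longrightarrow> 0 \<le> a r \<bullet> u" for u
  proof (rule nonneg_on_cone_K[OF assms])
    show "u \<in> cone_K P"
      using that[of None] that[of "Some _"]
      by (simp add: a_def cone_K_def inner_axis' less_eq_vec_def matrix_vector_mul_component)
  qed
  then obtain \<sigma> where \<sigma>: "\<forall>r. 0 \<le> \<sigma> r" "g = (\<Sum>r\<in>UNIV. \<sigma> r *\<^sub>R a r)"
    using farkas[of UNIV a g] by auto
  show thesis
  proof (rule that[of "\<sigma> \<circ> Some" "\<sigma> None"])
    show "g = (\<Sum>i\<in>UNIV. (\<sigma> \<circ> Some) i *\<^sub>R P $ i) + \<sigma> None *\<^sub>R axis None 1"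
      by (subst \<sigma>(2)) (simp add: UNIV_option_conv sum.reindex a_def add.commute)
  qed (use \<sigma>(1) in auto)
qed


section \<open>Products of rows in the inner approximation\<close>

lemma outer_add_left: "outer (a + b) c = outer a c + outer b c"
  and outer_add_right: "outer c (a + b) = outer c a + outer c b"
  and outer_diff_left: "outer (a - b) c = outer a c - outer b c"
  and outer_diff_right: "outer c (a - b) = outer c a - outer c b"
  by (simp_all add: outer_def vec_eq_iff algebra_simps)

lemma outer_congruence:
  "transpose P ** outer a b ** P = outer (transpose P *v a) (transpose P *v b)"
  by (simp add: outer_def vec_eq_iff matrix_matrix_mult_def matrix_vector_mult_def transpose_def
      sum_distrib_left sum_distrib_right mult_ac)

lemma matrix_add_rdistrib: "(A + B) ** C = A ** C + B ** C"
  by (simp add: matrix_matrix_mult_def vec_eq_iff sum.distrib algebra_simps)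

text \<open>Take \<open>W = 0\<close> and as multiplier matrix the symmetrized product of
  \<open>a\<close> and \<open>b\<close>, which is entrywise nonnegative.\<close>

lemma outer_rows_in_IA:
  assumes "0 \<le> a" "0 \<le> b"
  shows "(1/2) *\<^sub>R (outer (transpose P *v a) (transpose P *v b)
           + outer (transpose P *v b) (transpose P *v a)) \<in> IA P"
proof -
  define S where "S = (1/2) *\<^sub>R (outer a b + outer b a)"
  have "transpose S = S" "0 \<le> S"
    using assms by (simp_all add: S_def outer_def transpose_def vec_eq_iff less_eq_vec_def)
  moreover have "psd 0"
    by (simp add: psd_def transpose_def vec_eq_iff)
  moreover have "(1/2) *\<^sub>R (outer (transpose P *v a) (transpose P *v b)
           + outer (transpose P *v b) (transpose P *v a)) = 0 + transpose P ** S ** P"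
    by (simp add: S_def outer_congruence[symmetric] matrix_add_ldistrib matrix_add_rdistrib
        scalar_matrix_assoc[symmetric] matrix_scalar_ac scaleR_add_right
        del: transpose_matrix_vector)
  ultimately show ?thesis
    unfolding IA_def by blast
qed

lemma u_embed_add: "u_embed (a + b) = u_embed a + u_embed b"
  and u_embed_diff: "u_embed (a - b) = u_embed a - u_embed b"
  and u_embed_scaleR: "u_embed (t *\<^sub>R a) = t *\<^sub>R u_embed a"
  and u_embed_axis: "u_embed (axis k 1) = bas_u k"
  by (auto simp: u_embed_def vec_eq_iff axis_def split: sum.splits)

lemma u_embed_sum: "u_embed (sum f I) = (\<Sum>i\<in>I. u_embed (f i))"
  by (induction I rule: infinite_finite_induct)
    (simp_all add: u_embed_add, simp_all add: u_embed_def vec_eq_iff split: sum.splits)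

lemma nonneg_on_unc_set_in_IA:
  fixes P :: "real^('k::finite option)^('p::finite)"
    and h :: "'k \<Rightarrow> 'l::{finite,linorder} option \<Rightarrow> real"
  assumes "unc_set P \<noteq> {}" "compact (unc_set P)"
    and "\<And>u. u \<in> unc_set P \<Longrightarrow> 0 \<le> g \<bullet> u"
  shows "(1/2) *\<^sub>R (outer e_last (u_embed g) + outer (u_embed g) e_last) \<in> IA (P_lift P lo hi h)"
proof -
  obtain \<sigma> \<sigma>0 where \<sigma>: "\<And>i. 0 \<le> \<sigma> i" "0 \<le> \<sigma>0"
    and g: "g = (\<Sum>i\<in>UNIV. \<sigma> i *\<^sub>R P $ i) + \<sigma>0 *\<^sub>R axis None 1"
    using nonneg_on_unc_set_imp_combination[OF assms] by blast
  let ?T = "transpose (P_lift P lo hi h)"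
  \<comment> \<open>\<open>a\<close> selects the row \<open>e_last\<close>; \<open>b\<close> carries
    the Farkas multipliers, with \<open>\<sigma>0\<close> on that same row.\<close>
  define a :: "real^('p, 'k, 'l) cone_row" where "a = axis Row_last 1"
  define b :: "real^('p, 'k, 'l) cone_row"
    where "b = (\<Sum>i\<in>UNIV. \<sigma> i *\<^sub>R axis (Row_P i) 1) + \<sigma>0 *\<^sub>R axis Row_last 1"
  have row: "?T *v axis r 1 = P_lift P lo hi h $ r" for r
    by (simp add: matrix_vector_mult_basis column_def transpose_def vec_eq_iff)
  have "0 \<le> a" "0 \<le> b"
    using \<sigma> by (auto simp: a_def b_def less_eq_vec_def axis_def intro!: add_nonneg_nonneg sum_nonneg)
  moreover have "?T *v a = e_last"
    by (simp add: a_def row del: transpose_matrix_vector) (simp add: P_lift_def)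
  moreover have "?T *v b = u_embed g"
    by (simp add: b_def g matrix_vector_right_distrib linear_sum[OF matrix_vector_mul_linear]
        matrix_vector_mult_scaleR row u_embed_add u_embed_sum u_embed_scaleR u_embed_axis
        del: transpose_matrix_vector)
      (simp add: P_lift_def)
  ultimately show ?thesis
    using outer_rows_in_IA[of a b "P_lift P lo hi h"] by simp
qed


section \<open>Decision rules that are linear in the uncertain parameters\<close>

definition linear_rule :: "real^('k option)^'n \<Rightarrow> real^('k::finite, 'l::finite) wu_ix^'n::finite" where
  "linear_rule Y = (\<chi> n i. case i of Inl _ \<Rightarrow> 0 | Inr k \<Rightarrow> Y $ n $ k)"

lemma transpose_linear_rule_mult:
  "transpose (Y_embed (linear_rule Y)) *v v = u_embed (transpose Y *v v)"
  by (auto simp: vec_eq_iff matrix_vector_mult_def transpose_def Y_embed_def linear_rule_def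
      u_embed_def split: sum.splits)

lemma Theta_mult: "Theta A j *v x = u_embed (\<chi> k. A k $ j \<bullet> x)"
  by (auto simp: vec_eq_iff matrix_vector_mult_def Theta_def u_embed_def inner_vec_def
      split: sum.splits)

lemma inner_Theta_coeffs: "(\<chi> k. A k $ j \<bullet> x) \<bullet> u = (lin_mat A u *v x) $ j"
  by (simp add: inner_vec_def[of "vec_lambda _"] lin_mat_def matrix_vector_mul_component
      inner_sum_left mult.commute)

text \<open>The constant \<open>lam\<close> is homogenized: on the uncertainty set, where the last
  entry of \<open>u\<close> is 1, the form \<open>g\<close> evaluates to
  \<open>lam - d \<bullet> (Y *v u)\<close>.\<close>

lemma cop_objective_linear_rule:
  "cop_objective_mat h d lam (linear_rule Y) (\<lambda>_ _. 0) =
     (let g = lam *\<^sub>R axis None 1 - transpose Y *v d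
      in (1/2) *\<^sub>R (outer e_last (u_embed g) + outer (u_embed g) e_last))"
  by (simp add: cop_objective_mat_def Let_def transpose_linear_rule_mult u_embed_diff
      u_embed_scaleR u_embed_axis del: transpose_matrix_vector)
    (simp add: outer_def vec_eq_iff algebra_simps)

lemma cop_constraint_linear_rule:
  "cop_constraint_mat h A B H j x (linear_rule Y) 0 (\<lambda>_ _. 0) =
     (let g = (\<chi> k. A k $ j \<bullet> x) + transpose Y *v B $ j - H $ j
      in (1/2) *\<^sub>R (outer e_last (u_embed g) + outer (u_embed g) e_last))"
  by (simp add: cop_constraint_mat_def Let_def transpose_linear_rule_mult Theta_mult u_embed_diff
      u_embed_add outer_diff_left outer_diff_right outer_add_left outer_add_right algebra_simps
      del: transpose_matrix_vector)

lemma cop_value_IA_le_linear_rule: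
  fixes P :: "real^('k::finite option)^('p::finite)"
    and h :: "'k \<Rightarrow> 'l::{finite,linorder} option \<Rightarrow> real"
    and Y :: "real^('k option)^('n::finite)"
  assumes U: "unc_set P \<noteq> {}" "compact (unc_set P)"
    and x: "x \<in> X"
    and cost: "\<And>u. u \<in> unc_set P \<Longrightarrow> d \<bullet> (Y *v u) \<le> lam"
    and feasible: "\<And>u. u \<in> unc_set P \<Longrightarrow> H *v u \<le> lin_mat A u *v x + B *v (Y *v u)"
  shows "cop_value h X c d A B H (IA (P_lift P lo hi h)) \<le> ereal (c \<bullet> x + lam)"
proof -
  have adj: "(transpose Y *v v) \<bullet> u = v \<bullet> (Y *v u)" for v u
    by (metis dot_lmul_matrix transpose_matrix_vector)
  have "cop_objective_mat h d lam (linear_rule Y) (\<lambda>_ _. 0) \<in> IA (P_lift P lo hi h)"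
    unfolding cop_objective_linear_rule Let_def
    using cost
    by (intro nonneg_on_unc_set_in_IA[OF U])
      (auto simp: inner_diff_left adj inner_axis' unc_set_def simp del: transpose_matrix_vector)
  moreover have "cop_constraint_mat h A B H j x (linear_rule Y) 0 (\<lambda>_ _. 0) \<in> IA (P_lift P lo hi h)"
    for j
    unfolding cop_constraint_linear_rule Let_def
  proof (rule nonneg_on_unc_set_in_IA[OF U])
    fix u assume "u \<in> unc_set P"
    from feasible[OF this]
    show "0 \<le> ((\<chi> k. A k $ j \<bullet> x) + transpose Y *v B $ j - H $ j) \<bullet> u"
      by (simp add: less_eq_vec_def matrix_vector_mul_component[of B] matrix_vector_mul_component[of H]
          inner_diff_left inner_add_left adj inner_Theta_coeffs
          del: transpose_matrix_vector)
  qed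
  ultimately show ?thesis
    unfolding cop_value_def using x
    by (intro Inf_lower CollectI exI[of _ x] exI[of _ lam] exI[of _ "linear_rule Y"]
        exI[of _ "\<lambda>_. 0"] exI[of _ "\<lambda>_ _. 0"] exI[of _ "\<lambda>_ _ _. 0"]) simp
qed


section \<open>A linear selection of the outer approximation\<close>

lemma nxt_eq_Some_iff: "nxt l = Some l' \<longleftrightarrow> l < l' \<and> (\<forall>m. l < m \<longrightarrow> l' \<le> m)"
proof (cases "l = Max UNIV")
  case True
  then show ?thesis
    by (auto simp: nxt_def not_less)
next
  case False
  then have "l < Max UNIV"
    by (simp add: order_le_neq_trans)
  then have "{m. l < m} \<noteq> {}"
    by blast
  then show ?thesis
    using False Min_eq_iff[of "{m. l < m}" l'] by (auto simp: nxt_def)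
qed

lemma nxt_eq_None_iff: "nxt l = None \<longleftrightarrow> (\<forall>m. m \<le> l)"
  by (auto simp: nxt_def) (metis Max_eqI finite UNIV_I)

lemma inj_nxt: "inj nxt"
proof (rule injI)
  fix l m :: 'a
  assume eq: "nxt l = nxt m"
  show "l = m"
  proof (cases "nxt m")
    case None
    with eq show ?thesis
      by (simp add: nxt_eq_None_iff order_antisym)
  next
    case (Some l')
    with eq show ?thesis
      by (simp add: nxt_eq_Some_iff) (metis linorder_neqE not_le)
  qed
qed

text \<open>No position precedes the first one, so one inclusion is clear; injectivity of
  \<open>nxt\<close> gives both sides equal cardinality.\<close>

lemma range_nxt: "range nxt = UNIV - {Some fst_ix}"
proof (rule card_subset_eq)
  show "range nxt \<subseteq> UNIV - {Some (fst_ix :: 'a)}"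
    by (auto simp: nxt_eq_Some_iff fst_ix_def)
  show "card (range (nxt :: 'a \<Rightarrow> _)) = card (UNIV - {Some (fst_ix :: 'a)})"
    by (simp add: card_image inj_nxt card_UNIV_option)
qed simp

lemma sum_nxt_diff: "(\<Sum>l\<in>UNIV. f (nxt l) - f (Some l)) = f None - (f (Some fst_ix) :: real)"
proof -
  have "(\<Sum>l\<in>UNIV. f (nxt l)) = sum f (UNIV - {Some fst_ix})"
    by (simp add: range_nxt[symmetric] sum.reindex inj_nxt)
  also have "\<dots> = f None + (\<Sum>l\<in>UNIV. f (Some l)) - f (Some fst_ix)"
    by (simp add: sum_diff1 UNIV_option_conv sum.reindex)
  finally show ?thesis
    by (simp add: sum_subtractf)
qed

text \<open>Spreads \<open>u $ Some k - lo k\<close> over the segments in proportion to their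
  lengths. The factor \<open>u $ None\<close> makes the map linear instead of affine.\<close>

definition lin_w ::
  "('k \<Rightarrow> real) \<Rightarrow> ('k \<Rightarrow> real) \<Rightarrow> ('k \<Rightarrow> 'l option \<Rightarrow> real) \<Rightarrow> real^('k option)
    \<Rightarrow> real^('k::finite \<times> 'l::{finite,linorder})" where
  "lin_w lo hi h u = (\<chi> i. case i of (k, l) \<Rightarrow>
     (h k (nxt l) - h k (Some l)) * ((u $ Some k - lo k * u $ None) / (hi k - lo k)))"

lemma linear_stack_lin_w: "linear (\<lambda>u. stack (lin_w lo hi h u) u)"
  by (rule linearI)
    (auto simp: stack_def lin_w_def vec_eq_iff algebra_simps add_divide_distrib diff_divide_distrib
      split: sum.splits prod.splits)

lemma lin_w_in_U_GWK:
  fixes h :: "'k::finite \<Rightarrow> 'l::{finite,linorder} option \<Rightarrow> real"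
  assumes u: "u \<in> unc_set P"
    and bounds: "\<And>k. u $ Some k \<in> {lo k..hi k}"
    and first: "\<And>k. h k (Some fst_ix) = lo k"
    and mono: "\<And>k l. h k (Some l) < h k (nxt l)"
    and last: "\<And>k. h k None = hi k"
  shows "(lin_w lo hi h u, u) \<in> U_GWK P lo h"
proof -
  have tel: "(\<Sum>l\<in>UNIV. h k (nxt l) - h k (Some l)) = hi k - lo k" for k
    using sum_nxt_diff[of "h k"] first last by simp
  \<comment> \<open>A nonempty sum of positive segment lengths, so the denominator in
    \<open>lin_w\<close> is positive.\<close>
  have lt: "lo k < hi k" for k
    using sum_pos[of UNIV "\<lambda>l. h k (nxt l) - h k (Some l)"] mono tel[of k] by simp
  have one: "u $ None = 1"
    using u by (simp add: unc_set_def)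
  have w: "lin_w lo hi h u $ (k, l)
      = (h k (nxt l) - h k (Some l)) * ((u $ Some k - lo k) / (hi k - lo k))" for k l
    by (simp add: lin_w_def one)
  have "(\<Sum>l\<in>UNIV. lin_w lo hi h u $ (k, l)) = u $ Some k - lo k" for k
    unfolding w sum_distrib_right[symmetric] tel using lt[of k] by simp
  moreover have "lin_w lo hi h u $ (k, fst_ix) \<le> h k (nxt fst_ix) - lo k" for k
  proof -
    have "(u $ Some k - lo k) / (hi k - lo k) \<le> 1"
      using lt[of k] bounds[of k] by simp
    then have "(h k (nxt fst_ix) - lo k) * ((u $ Some k - lo k) / (hi k - lo k))
        \<le> (h k (nxt fst_ix) - lo k) * 1"
      using mono[of k fst_ix] by (intro mult_left_mono) (simp_all add: first)
    then show ?thesis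
      unfolding w first by (simp only: mult_1_right)
  qed
  ultimately show ?thesis
    \<comment> \<open>The ratio inequalities between adjacent segments hold with equality, since the
      weights are proportional to the lengths.\<close>
    using u by (auto simp: U_GWK_def w mult_ac)
qed

section \<open>Comparison of the optimal values\<close>

theorem theorem6:
  fixes P :: "real^('k::finite option)^('p::finite)"
    and lo hi :: "'k \<Rightarrow> real"
    and h :: "'k \<Rightarrow> 'l::{finite,linorder} option \<Rightarrow> real"
    and X :: "(real^('m::finite)) set"
    and c :: "real^'m"
    and d :: "real^('n::finite)"
    and A :: "'k option \<Rightarrow> real^'m^('j::finite)"
    and B :: "real^'n^'j"
    and H :: "real^('k option)^'j"
  assumes "unc_set P \<noteq> {}"
    and "compact (unc_set P)"
    and "\<And>k. (\<lambda>u. u $ Some k) ` unc_set P = {lo k..hi k}"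
    and "\<And>k. h k (Some fst_ix) = lo k"
    and "\<And>k l. h k (Some l) < h k (nxt l)"
    and "\<And>k. h k None = hi k"
  shows "Z_IA P lo hi h X c d A B H \<le> Z_GWK P lo h X c d A B H"
  unfolding Z_GWK_def Z_val_def
proof (rule Inf_greatest, clarify)
  fix x and Y :: "real^('k, 'l) wu_ix^'n"
  assume x: "x \<in> X"
    and feasible: "\<forall>(w, u)\<in>U_GWK P lo h. H *v u \<le> lin_mat A u *v x + B *v (Y *v stack w u)"
  let ?cost = "SUP (w, u)\<in>U_GWK P lo h. ereal (d \<bullet> (Y *v stack w u))"
  have sel: "(lin_w lo hi h u, u) \<in> U_GWK P lo h" if "u \<in> unc_set P" for u
    using that assms(3) by (intro lin_w_in_U_GWK assms(4-6)) blast+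
  define T :: "real^('k option) \<Rightarrow> real^('k, 'l) wu_ix" where "T u = stack (lin_w lo hi h u) u" for u
  \<comment> \<open>The given rule evaluated along the linear selection, hence a matrix acting on
    \<open>u\<close> alone.\<close>
  define Y' where "Y' = Y ** matrix T"
  have "linear T"
    using linear_stack_lin_w unfolding T_def .
  then have Y': "Y' *v u = Y *v stack (lin_w lo hi h u) u" for u
    unfolding Y'_def by (simp add: matrix_works T_def flip: matrix_vector_mul_assoc)
  have bound: "ereal (d \<bullet> (Y' *v u)) \<le> ?cost" if "u \<in> unc_set P" for u
    using SUP_upper[OF sel[OF that], of "\<lambda>(w, u). ereal (d \<bullet> (Y *v stack w u))"] by (simp add: Y')
  show "Z_IA P lo hi h X c d A B H \<le> ereal (c \<bullet> x) + ?cost"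
  proof (cases ?cost)
    case (real lam)
    have "Z_IA P lo hi h X c d A B H \<le> ereal (c \<bullet> x + lam)"
      unfolding Z_IA_def
    proof (rule cop_value_IA_le_linear_rule[where Y = Y'])
      show "d \<bullet> (Y' *v u) \<le> lam" if "u \<in> unc_set P" for u
        using bound[OF that] real by simp
      show "H *v u \<le> lin_mat A u *v x + B *v (Y' *v u)" if "u \<in> unc_set P" for u
        using feasible sel[OF that] by (auto simp: Y')
    qed (use assms(1,2) x in auto)
    then show ?thesis
      using real by simp
  next
    case PInf
    then show ?thesis
      by simp
  next
    \<comment> \<open>Excluded: any point of the nonempty uncertainty set bounds
      \<open>?cost\<close> below by a real number.\<close>
    case MInf
    with bound assms(1) show ?thesis
      by auto
  qed
qed

end
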